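(* Let $\mathbb{L}\subset\mathbb{Z}^N$ be a rank $2$ lattice and let $\mathsf{P}$ be a quiver with superpotential such that $\mathsf{P}$ satisfies Condition 1 and the pair $(\mathbb{L},\mathsf{P})$ satisfies Condition 2 (all as defined in the context), with elements $\varepsilon_{\mathbf{b}},\varepsilon_{\mathbf{w}}\in\mathbb{Z}^N/\mathbb{L}$ as in Condition 2. Then for every $\xi\in\mathcal{G}_{\mathbb{L}}$: $$\mathbb{K}_{\mathsf{P}}(\mathbf{z},\xi\mathbf{u})=\mathrm{diag}(\xi(\varepsilon_{\mathbf{b}}))\,\mathbb{K}_{\mathsf{P}}(\mathbf{z},\mathbf{u})\,\mathrm{diag}(\xi(-\varepsilon_{\mathbf{w}})),$$ $$\det\mathbb{K}_{\mathsf{P}}(\mathbf{z},\xi\mathbf{u})=\chi(\xi)\det\mathbb{K}_{\mathsf{P}}(\mathbf{z},\mathbf{u}),$$ and moreover $$\deg_{\mathbf{z}}\det\mathbb{K}_{\mathsf{P}}(\mathbf{z},\mathbf{u})=\tfrac12\deg_{\mathbf{u}}\det\mathbb{K}_{\mathsf{P}}(\mathbf{z},\mathbf{u})=\sharp\mathsf{P}^{2\bullet}=\sharp\mathsf{P}^{2\circ}=\tfrac12\,\overline{h}(\mathbf{a}_0).$$ Here the entries of the diagonal matrices $\mathrm{diag}(\xi(\varepsilon_{\mathbf{b}}))$ and $\mathrm{diag}(\xi(-\varepsilon_{\mathbf{w}}))$ are labeled by the black and white $2$-cells in agreement with the labeling of the rows and columns of $\mathbb{K}_{\mathsf{P}}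(\mathbf{z},\mathbf{u})$.
   Context: **The lattice and its group.** $\mathbb{L}$ is a rank $2$ subgroup of $\mathbb{Z}^N$, not contained in any standard coordinate hyperplane, and contained in the kernel of $h:\mathbb{Z}^N\to\mathbb{Z}$, $h(z_1,\ldots,z_N)=z_1+\cdots+z_N$. Torsion in $\mathbb{Z}^N/\mathbb{L}$ is allowed. Let $\overline{h}:\mathbb{Z}^N/\mathbb{L}\to\mathbb{Z}$ be the map induced by $h$. With $\mathbf{e}_1,\ldots,\mathbf{e}_N$ the standard basis, put $\mathbf{a}_i=\mathbf{e}_i\bmod\mathbb{L}\in\mathbb{Z}^N/\mathbb{L}$ and $\mathcal{G}_{\mathbb{L}}=\mathrm{Hom}(\mathbb{Z}^N/\mathbb{L},\mathbb{C}^* )$. An element $\xi\in\mathcal{G}_{\mathbb{L}}$ acts by $\xi\mathbf{u}=(\xi(\mathbf{a}_1)u_1,\ldots,\xi(\mathbf{a}_N)u_N)$ on the tuple of variables $\mathbf{u}=(u_1,\ldots,u_N)$. **The element $\mathbf{a}_0$ and character $\chi$.** Choose a basis of $\mathbb{L}$ and represent $\mathbb{L}\hookrightarrow\mathbb{Z}^N$ by the $2\times N$ integer matrix $B$ whose rows are the basis vectors; let $\beta_1,\ldots,\beta_N\in\mathbb{Z}^2$ be its columns. For $\mathbf{c}\in\mathbb{R}^2\setminus\bigcup_i\mathbb{R}_{\ge0}\beta_i$ put $L_{\mathbf{c}}=\{\{i,j\}\subset\{1,\ldots,N\}\mid \mathbf{c}\in\mathbb{R}_{\ge0}\beta_i+\mathbb{R}_{\ge0}\beta_j\}$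 and $$\mathbf{a}_0=\sum_{\{i,j\}\in L_{\mathbf{c}}}|\det(\beta_i,\beta_j)|\,(\mathbf{a}_i+\mathbf{a}_j)\in\mathbb{Z}^N/\mathbb{L},$$ which is independent of the choices of $\mathbf{c}$ and of the basis. Define $\chi:\mathcal{G}_{\mathbb{L}}\to\mathbb{C}^*$ by $\chi(\xi)=\xi(\mathbf{a}_0)$. **Quiver with superpotential.** $\mathsf{P}$ consists of four finite sets $\mathsf{P}^0$ (nodes), $\mathsf{P}^1$ (arrows), $\mathsf{P}^{2\bullet}$ (black $2$-cells), $\mathsf{P}^{2\circ}$ (white $2$-cells) and maps $s,t:\mathsf{P}^1\to\mathsf{P}^0$, $\mathbf{b}:\mathsf{P}^1\to\mathsf{P}^{2\bullet}$, $\mathbf{w}:\mathsf{P}^1\to\mathsf{P}^{2\circ}$. An arrow $e$ is oriented from $s(e)$ to $t(e)$. The nodes are $\mathsf{P}^0=\{1,\ldots,N\}$. **Condition 1.** (1) The directed graph $(\mathsf{P}^0,\mathsf{P}^1,s,t)$ is connected, has no oriented cycles of length $\le2$, and every node has as many incoming as outgoing arrows. (2) $\sharp\mathsf{P}^{2\bullet}=\sharp\mathsf{P}^{2\circ}$. (3) For every black $2$-cell $\mathbf{b}$ and every white $2$-cell $\mathbf{w}$ the sets $\{e\in\mathsf{P}^1\mid\mathbf{b}(e)=\mathbf{b}\}$ and $\{e\in\mathsf{P}^1\mid\mathbf{w}(e)=\mathbf{w}\}$ are connected oriented cycles, i.e. the elements can be ordered $(e_1,\ldots,e_r)$ with $t(e_i)=s(e_{i+1})$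 for $1\le i<r$ and $t(e_r)=s(e_1)$. **Condition 2.** For every $\mathbf{b}\in\mathsf{P}^{2\bullet}$ and $\mathbf{w}\in\mathsf{P}^{2\circ}$ there are elements $\varepsilon_{\mathbf{b}},\varepsilon_{\mathbf{w}}\in\mathbb{Z}^N/\mathbb{L}$ such that $\mathbf{a}_{s(e)}+\mathbf{a}_{t(e)}=\varepsilon_{\mathbf{b}(e)}-\varepsilon_{\mathbf{w}(e)}$ for every $e\in\mathsf{P}^1$, and $\mathbf{a}_0=\sum_{\mathbf{b}\in\mathsf{P}^{2\bullet}}\varepsilon_{\mathbf{b}}-\sum_{\mathbf{w}\in\mathsf{P}^{2\circ}}\varepsilon_{\mathbf{w}}$. **Bi-adjacency matrix.** $\mathbb{K}_{\mathsf{P}}(\mathbf{z},\mathbf{u})$ is the square matrix with rows indexed by black and columns indexed by white $2$-cells, with entries in the polynomial ring $\mathbb{Z}[z_e,u_i\mid e\in\mathsf{P}^1,i\in\mathsf{P}^0]$ and $(\mathbf{b},\mathbf{w})$-entry $$\sum_{e\in\mathsf{P}^1:\ \mathbf{b}(e)=\mathbf{b},\ \mathbf{w}(e)=\mathbf{w}}z_e\,u_{s(e)}u_{t(e)}.$$ $\deg_{\mathbf{z}}$ and $\deg_{\mathbf{u}}$ denote total degree in the variables $z_e$, respectively $u_i$.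
   Formalization: The final chain of equalities (the degrees, the numbers of 2-cells and half of h̄(a₀)) is proved under the added assumption that det K_P(z,u) is nonzero; Conditions 1 and 2 alone allow det K_P = 0, where the chain fails. *)

theory Defs
  imports
    "HOL-Analysis.Analysis"
    "HOL-Algebra.Coset"
    "HOL-Algebra.FiniteProduct"
    "HOL-Library.Poly_Mapping"
begin

section \<open>The lattice and its group\<close>

text \<open>\<open>'n\<close> is the index set \<open>{1..N}\<close>; its linear order is used only to write
  two-element subsets \<open>{i, j}\<close> as pairs with \<open>i < j\<close>.\<close>

type_synonym 'n zvec = "(int, 'n) vec"
type_synonym 'n zmat2 = "int ^ 'n ^ 2"

definition hsum :: "'n::finite zvec \<Rightarrow> int" where
  "hsum v = (\<Sum>i\<in>UNIV. v $ i)"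

definition ZN :: "'n::finite zvec monoid" where
  "ZN = \<lparr>carrier = UNIV, mult = (+), one = 0\<rparr>"

definition is_basis_matrix :: "'n::finite zvec set \<Rightarrow> 'n zmat2 \<Rightarrow> bool" where
  "is_basis_matrix L B \<longleftrightarrow>
     L = {k *s row 1 B + l *s row 2 B | k l. True} \<and>
     (\<forall>k l. k *s row 1 B + l *s row 2 B = 0 \<longrightarrow> k = 0 \<and> l = 0)"

definition rank2_lattice :: "'n::finite zvec set \<Rightarrow> bool" where
  "rank2_lattice L \<longleftrightarrow>
     subgroup L ZN \<and>
     (\<exists>B. is_basis_matrix L B) \<and>
     (\<forall>i. \<not> L \<subseteq> {v. v $ i = 0}) \<and>
     L \<subseteq> {v. hsum v = 0}"

text \<open>\<open>\<int>\<^sup>N / L\<close>. Its elements are cosets, and its group law is written multiplicatively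
  in HOL-Algebra: \<open>\<otimes>\<close>, \<open>inv\<close>, \<open>[^]\<close> and \<open>finprod\<close> stand for \<open>+\<close>, \<open>-\<close>, integer
  multiples and finite sums.\<close>

abbreviation quot :: "'n::finite zvec set \<Rightarrow> 'n zvec set monoid" where
  "quot L \<equiv> ZN Mod L"

definition hbar :: "'n::finite zvec set \<Rightarrow> int" where
  "hbar X = the_elem (hsum ` X)"

definition avec :: "'n::finite zvec set \<Rightarrow> 'n \<Rightarrow> 'n zvec set" where
  "avec L i = L #>\<^bsub>ZN\<^esub> axis i 1"

definition Cstar :: "complex monoid" where
  "Cstar = \<lparr>carrier = UNIV - {0}, mult = (*), one = 1\<rparr>"

definition char_group :: "'n::finite zvec set \<Rightarrow> ('n zvec set \<Rightarrow> complex) set" where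
  "char_group L = hom (quot L) Cstar"


section \<open>The element \<open>a\<^sub>0\<close> and the character \<open>\<chi>\<close>\<close>

definition beta_real :: "'n::finite zmat2 \<Rightarrow> 'n \<Rightarrow> real ^ 2" where
  "beta_real B i = (\<chi> r. real_of_int (column i B $ r))"

definition generic_direction :: "'n::finite zmat2 \<Rightarrow> real ^ 2 \<Rightarrow> bool" where
  "generic_direction B c \<longleftrightarrow> c \<notin> (\<Union>i. {x *\<^sub>R beta_real B i | x. x \<ge> 0})"

definition Lpairs :: "'n::{finite,linorder} zmat2 \<Rightarrow> real ^ 2 \<Rightarrow> ('n \<times> 'n) set" where
  "Lpairs B c = {(i, j). i < j \<and>
     (\<exists>x\<ge>0. \<exists>y\<ge>0. c = x *\<^sub>R beta_real B i + y *\<^sub>R beta_real B j)}"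

definition a0 :: "'n::{finite,linorder} zvec set \<Rightarrow> 'n zmat2 \<Rightarrow> real ^ 2 \<Rightarrow> 'n zvec set" where
  "a0 L B c = finprod (quot L)
     (\<lambda>(i, j). (avec L i \<otimes>\<^bsub>quot L\<^esub> avec L j)
        [^]\<^bsub>quot L\<^esub> \<bar>det (vector [column i B, column j B] :: int ^ 2 ^ 2)\<bar>)
     (Lpairs B c)"

definition chi_char ::
  "'n::{finite,linorder} zvec set \<Rightarrow> 'n zmat2 \<Rightarrow> real ^ 2 \<Rightarrow> ('n zvec set \<Rightarrow> complex) \<Rightarrow> complex" where
  "chi_char L B c \<xi> = \<xi> (a0 L B c)"


section \<open>Quivers with superpotential\<close>

text \<open>The finite sets of nodes, arrows, black and white 2-cells are the finite types
  \<open>'n\<close>, \<open>'e\<close>, \<open>'b\<close>, \<open>'w\<close>.\<close>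

record ('n, 'e, 'b, 'w) quiver =
  src :: "'e \<Rightarrow> 'n"
  tgt :: "'e \<Rightarrow> 'n"
  black :: "'e \<Rightarrow> 'b"
  white :: "'e \<Rightarrow> 'w"

definition quiver_connected :: "('n, 'e, 'b, 'w) quiver \<Rightarrow> bool" where
  "quiver_connected P \<longleftrightarrow>
     (let E = {(src P e, tgt P e) | e. True} in \<forall>i j. (i, j) \<in> (E \<union> E\<inverse>)\<^sup>*)"

definition is_oriented_cycle :: "('n, 'e, 'b, 'w) quiver \<Rightarrow> 'e set \<Rightarrow> bool" where
  "is_oriented_cycle P S \<longleftrightarrow>
     (\<exists>es. es \<noteq> [] \<and> distinct es \<and> set es = S \<and>
       (\<forall>i < length es. tgt P (es ! i) = src P (es ! (Suc i mod length es))))"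

definition condition1 :: "('n, 'e::finite, 'b::finite, 'w::finite) quiver \<Rightarrow> bool" where
  "condition1 P \<longleftrightarrow>
     quiver_connected P \<and>
     (\<forall>e. src P e \<noteq> tgt P e) \<and>
     (\<forall>e f. \<not> (tgt P e = src P f \<and> tgt P f = src P e)) \<and>
     (\<forall>i. card {e. tgt P e = i} = card {e. src P e = i}) \<and>
     CARD('b) = CARD('w) \<and>
     (\<forall>b. is_oriented_cycle P {e. black P e = b}) \<and>
     (\<forall>w. is_oriented_cycle P {e. white P e = w})"

text \<open>Condition 2 for given \<open>\<epsilon>\<^sub>b\<close>, \<open>\<epsilon>\<^sub>w\<close>; the argument \<open>a\<close> is the element \<open>a\<^sub>0\<close>.\<close>

definition condition2 ::
  "'n::finite zvec set \<Rightarrow> 'n zvec set \<Rightarrow> ('n, 'e::finite, 'b::finite, 'w::finite) quiver \<Rightarrow>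
   ('b \<Rightarrow> 'n zvec set) \<Rightarrow> ('w \<Rightarrow> 'n zvec set) \<Rightarrow> bool" where
  "condition2 L a P eb ew \<longleftrightarrow>
     (\<forall>b. eb b \<in> carrier (quot L)) \<and>
     (\<forall>w. ew w \<in> carrier (quot L)) \<and>
     (\<forall>e. avec L (src P e) \<otimes>\<^bsub>quot L\<^esub> avec L (tgt P e) =
          eb (black P e) \<otimes>\<^bsub>quot L\<^esub> inv\<^bsub>quot L\<^esub> ew (white P e)) \<and>
     a = finprod (quot L) eb UNIV \<otimes>\<^bsub>quot L\<^esub> inv\<^bsub>quot L\<^esub> finprod (quot L) ew UNIV"


section \<open>Polynomials and the bi-adjacency matrix\<close>

text \<open>Polynomials with coefficients in \<open>'r\<close> in the variables \<open>z\<^sub>e\<close> (tagged \<open>Inl e\<close>) and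
  \<open>u\<^sub>i\<close> (tagged \<open>Inr i\<close>), as finitely supported coefficient functions on monomials.\<close>

type_synonym ('e, 'n, 'r) zupoly = "('e + 'n \<Rightarrow>\<^sub>0 nat) \<Rightarrow>\<^sub>0 'r"

definition pvar :: "'v \<Rightarrow> ('v \<Rightarrow>\<^sub>0 nat) \<Rightarrow>\<^sub>0 'r::comm_ring_1" where
  "pvar v = Poly_Mapping.single (Poly_Mapping.single v 1) 1"

definition pconst :: "'r \<Rightarrow> ('v \<Rightarrow>\<^sub>0 nat) \<Rightarrow>\<^sub>0 'r::comm_ring_1" where
  "pconst a = Poly_Mapping.single 0 a"

definition zvar :: "'e \<Rightarrow> ('e, 'n, 'r::comm_ring_1) zupoly" where
  "zvar e = pvar (Inl e)"

definition uvar :: "'n \<Rightarrow> ('e, 'n, 'r::comm_ring_1) zupoly" where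
  "uvar i = pvar (Inr i)"

text \<open>The tuple \<open>\<xi>u\<close>.\<close>

definition act_u ::
  "'n::finite zvec set \<Rightarrow> ('n zvec set \<Rightarrow> complex) \<Rightarrow> 'n \<Rightarrow> ('e, 'n, complex) zupoly" where
  "act_u L \<xi> i = pconst (\<xi> (avec L i)) * uvar i"

text \<open>Total degree in the variables from \<open>V\<close>. The zero polynomial gets the dummy value 0;
  degrees are only meant for nonzero polynomials.\<close>

definition deg_in :: "'v set \<Rightarrow> (('v::finite \<Rightarrow>\<^sub>0 nat) \<Rightarrow>\<^sub>0 'r::zero) \<Rightarrow> nat" where
  "deg_in V p =
     Max (insert 0 ((\<lambda>m. \<Sum>v\<in>V. Poly_Mapping.lookup m v) ` Poly_Mapping.keys p))"

definition deg_z :: "('e::finite, 'n::finite, 'r::zero) zupoly \<Rightarrow> nat" where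
  "deg_z p = deg_in (range Inl) p"

definition deg_u :: "('e::finite, 'n::finite, 'r::zero) zupoly \<Rightarrow> nat" where
  "deg_u p = deg_in (range Inr) p"

text \<open>\<open>K\<^sub>P(z, u)\<close> for tuples \<open>z\<close>, \<open>u\<close> in a commutative ring. At \<open>z = zvar\<close>, \<open>u = uvar\<close> with
  integer coefficients it is the polynomial matrix itself, at \<open>u = act_u L \<xi>\<close> it is
  \<open>K\<^sub>P(z, \<xi>u)\<close>.\<close>

definition biadj ::
  "('n, 'e::finite, 'b::finite, 'w::finite) quiver \<Rightarrow> ('e \<Rightarrow> 'a) \<Rightarrow> ('n \<Rightarrow> 'a) \<Rightarrow>
   'a::comm_ring_1 ^ 'w ^ 'b" where
  "biadj P z u = (\<chi> b w. \<Sum>e | black P e = b \<and> white P e = w. z e * u (src P e) * u (tgt P e))"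

definition diag_mat :: "('i \<Rightarrow> 'a) \<Rightarrow> 'a::comm_ring_1 ^ 'i ^ 'i" where
  "diag_mat d = (\<chi> i j. if i = j then d i else 0)"

text \<open>The determinant of a matrix whose rows and columns are indexed by different types depends
  on how both are labelled by a common index set \<open>'k\<close> (another labelling may change the sign).\<close>

definition labelled_det ::
  "('k::finite \<Rightarrow> 'b) \<Rightarrow> ('k \<Rightarrow> 'w) \<Rightarrow> 'a::comm_ring_1 ^ 'w ^ 'b \<Rightarrow> 'a" where
  "labelled_det p q M = det ((\<chi> i j. M $ p i $ q j) :: 'a ^ 'k ^ 'k)"

end

theory Submission
  imports Defs
begin

text \<open>
  The main input is the first relation of Condition 2: the weight \<open>a\<^bsub>s(e)\<^esub> + a\<^bsub>t(e)\<^esub>\<close> of the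
  monomial \<open>u\<^bsub>s(e)\<^esub> u\<^bsub>t(e)\<^esub>\<close> is a part depending only on the row \<open>b(e)\<close> minus a part depending only
  on the column \<open>w(e)\<close>.

  A character \<open>\<xi>\<close> therefore multiplies every summand of the \<open>(b, w)\<close>-entry by the same scalar
  \<open>\<xi>(\<epsilon>\<^sub>b) \<xi>(-\<epsilon>\<^sub>w)\<close>, which is the diagonal scaling (\<open>biadj_act_u\<close>). Taking determinants, the scalars
  multiply to the value of \<open>\<xi>\<close> at \<open>\<Sum> \<epsilon>\<^sub>b - \<Sum> \<epsilon>\<^sub>w = a\<^sub>0\<close> (\<open>labelled_det_diag_scale\<close>,
  \<open>prod_char_eps\<close>).

  For the degrees, each entry is homogeneous of degree 1 in \<open>z\<close> and of degree 2 in \<open>u\<close>, so a nonzero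
  determinant of an \<open>n \<times> n\<close> matrix of such entries has exactly the degrees \<open>n\<close> and \<open>2n\<close>
  (\<open>homogeneous_in_labelled_det\<close>, \<open>deg_in_homogeneous\<close>). To find \<open>h(a\<^sub>0)\<close>, apply \<open>h\<close>
  to the same relation: \<open>h(\<epsilon>\<^bsub>b(e)\<^esub>) - h(\<epsilon>\<^bsub>w(e)\<^esub>) = 2\<close> for every arrow \<open>e\<close>. A nonzero determinant has a
  nonzero term in its Leibniz expansion, i.e. a perfect matching of black and white cells by
  arrows (\<open>labelled_det_nonzero_matching\<close>), and adding up this equation over the matching gives
  \<open>h(a\<^sub>0) = 2n\<close> (\<open>hbar_of_matching\<close>).
\<close>

section \<open>Homomorphisms out of the quotient group\<close>

lemma comm_group_ZN: "comm_group (ZN :: 'n::finite zvec monoid)"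
proof (rule comm_groupI)
  fix x :: "'n zvec"
  show "\<exists>y\<in>carrier ZN. y \<otimes>\<^bsub>ZN\<^esub> x = \<one>\<^bsub>ZN\<^esub>"
    by (rule bexI[of _ "- x"]) (simp_all add: ZN_def)
qed (simp_all add: ZN_def ac_simps)

lemma rank2_lattice_subgroup: "rank2_lattice L \<Longrightarrow> subgroup L ZN"
  by (simp add: rank2_lattice_def)

lemma comm_group_quot: "rank2_lattice L \<Longrightarrow> comm_group (quot L)"
  by (simp add: comm_group.abelian_FactGroup comm_group_ZN rank2_lattice_subgroup)

lemma avec_closed: "avec L i \<in> carrier (quot L)"
  by (auto simp: avec_def carrier_FactGroup ZN_def)

lemma (in comm_monoid) finprod_to_prod:
  fixes \<phi> :: "'a \<Rightarrow> 'r::comm_monoid_mult"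
  assumes "\<phi> \<one> = 1"
    and "\<And>x y. x \<in> carrier G \<Longrightarrow> y \<in> carrier G \<Longrightarrow> \<phi> (x \<otimes> y) = \<phi> x * \<phi> y"
    and "f \<in> A \<rightarrow> carrier G"
  shows "\<phi> (finprod G f A) = (\<Prod>x\<in>A. \<phi> (f x))"
  using assms(3)
proof (induction A rule: infinite_finite_induct)
  case (insert a A)
  then show ?case by (simp add: assms(2) Pi_iff)
qed (simp_all add: assms(1))

lemma (in comm_monoid) finprod_to_sum:
  fixes \<phi> :: "'a \<Rightarrow> 'r::comm_monoid_add"
  assumes "\<phi> \<one> = 0"
    and "\<And>x y. x \<in> carrier G \<Longrightarrow> y \<in> carrier G \<Longrightarrow> \<phi> (x \<otimes> y) = \<phi> x + \<phi> y"
    and "f \<in> A \<rightarrow> carrier G"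
  shows "\<phi> (finprod G f A) = (\<Sum>x\<in>A. \<phi> (f x))"
  using assms(3)
proof (induction A rule: infinite_finite_induct)
  case (insert a A)
  then show ?case by (simp add: assms(2) Pi_iff)
qed (simp_all add: assms(1))

lemma char_mult:
  assumes "\<xi> \<in> char_group L" "X \<in> carrier (quot L)" "Y \<in> carrier (quot L)"
  shows "\<xi> (X \<otimes>\<^bsub>quot L\<^esub> Y) = \<xi> X * \<xi> Y"
  using hom_mult[of \<xi> "quot L" Cstar X Y] assms by (simp add: char_group_def Cstar_def)

lemma char_nonzero:
  assumes "\<xi> \<in> char_group L" "X \<in> carrier (quot L)"
  shows "\<xi> X \<noteq> 0"
  using hom_carrier[of \<xi> "quot L" Cstar] assms by (auto simp: char_group_def Cstar_def)

lemma char_one: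
  assumes "rank2_lattice L" "\<xi> \<in> char_group L"
  shows "\<xi> \<one>\<^bsub>quot L\<^esub> = 1"
proof -
  interpret G: comm_group "quot L" by (rule comm_group_quot[OF assms(1)])
  have "\<xi> \<one>\<^bsub>quot L\<^esub> = \<xi> \<one>\<^bsub>quot L\<^esub> * \<xi> \<one>\<^bsub>quot L\<^esub>"
    using char_mult[OF assms(2) G.one_closed G.one_closed] G.l_one[OF G.one_closed] by metis
  then show ?thesis using char_nonzero[OF assms(2) G.one_closed] by simp
qed

lemma char_inv:
  assumes "rank2_lattice L" "\<xi> \<in> char_group L" "X \<in> carrier (quot L)"
  shows "\<xi> (inv\<^bsub>quot L\<^esub> X) = inverse (\<xi> X)"
proof -
  interpret G: comm_group "quot L" by (rule comm_group_quot[OF assms(1)])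
  have "\<xi> (inv\<^bsub>quot L\<^esub> X) * \<xi> X = 1"
    using char_mult[OF assms(2) G.inv_closed[OF assms(3)] assms(3)]
      G.l_inv[OF assms(3)] char_one[OF assms(1,2)] by metis
  then show ?thesis by (metis inverse_unique mult.commute)
qed

lemma char_finprod:
  assumes "rank2_lattice L" "\<xi> \<in> char_group L" "f \<in> A \<rightarrow> carrier (quot L)"
  shows "\<xi> (finprod (quot L) f A) = (\<Prod>x\<in>A. \<xi> (f x))"
proof -
  interpret G: comm_group "quot L" by (rule comm_group_quot[OF assms(1)])
  show ?thesis
    by (rule G.finprod_to_prod[OF char_one[OF assms(1,2)] char_mult[OF assms(2)] assms(3)])
qed

text \<open>Since \<open>h\<close> vanishes on \<open>L\<close>, it is constant on each coset, so that \<open>hbar\<close>, which is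
  \<open>the_elem\<close> of an image, does return the value of \<open>h\<close> on any representative.\<close>

lemma hbar_coset:
  assumes "rank2_lattice L"
  shows "hbar (L #>\<^bsub>ZN\<^esub> v) = hsum v"
proof -
  have "0 \<in> L"
    using subgroup.one_closed[OF rank2_lattice_subgroup[OF assms]] by (simp add: ZN_def)
  moreover have "hsum l = 0" if "l \<in> L" for l
    using assms that by (auto simp: rank2_lattice_def)
  ultimately have "hsum ` (L #>\<^bsub>ZN\<^esub> v) = {hsum v}"
    by (force simp: r_coset_def ZN_def hsum_def sum.distrib)
  then show ?thesis by (simp add: hbar_def)
qed

lemma hbar_avec: "rank2_lattice L \<Longrightarrow> hbar (avec L i) = 1"
  by (simp add: avec_def hbar_coset hsum_def axis_def)

lemma hbar_mult:
  assumes "rank2_lattice L" "X \<in> carrier (quot L)" "Y \<in> carrier (quot L)"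
  shows "hbar (X \<otimes>\<^bsub>quot L\<^esub> Y) = hbar X + hbar Y"
proof -
  interpret Z: comm_group ZN by (rule comm_group_ZN)
  interpret N: normal L ZN
    using Z.normal_iff_subgroup rank2_lattice_subgroup[OF assms(1)] by blast
  obtain x y where xy: "X = L #>\<^bsub>ZN\<^esub> x" "Y = L #>\<^bsub>ZN\<^esub> y"
    using assms(2,3) by (auto simp: carrier_FactGroup)
  have "X \<otimes>\<^bsub>quot L\<^esub> Y = L #>\<^bsub>ZN\<^esub> (x + y)"
    using N.rcos_sum[of x y] by (simp add: xy ZN_def)
  then show ?thesis
    by (simp add: xy hbar_coset[OF assms(1)] hsum_def sum.distrib)
qed

lemma hbar_one:
  assumes "rank2_lattice L"
  shows "hbar \<one>\<^bsub>quot L\<^esub> = 0"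
proof -
  interpret G: comm_group "quot L" by (rule comm_group_quot[OF assms])
  show ?thesis
    using hbar_mult[OF assms G.one_closed G.one_closed] G.l_one[OF G.one_closed] by simp
qed

lemma hbar_inv:
  assumes "rank2_lattice L" "X \<in> carrier (quot L)"
  shows "hbar (inv\<^bsub>quot L\<^esub> X) = - hbar X"
proof -
  interpret G: comm_group "quot L" by (rule comm_group_quot[OF assms(1)])
  have "hbar (inv\<^bsub>quot L\<^esub> X) + hbar X = 0"
    using hbar_mult[OF assms(1) G.inv_closed[OF assms(2)] assms(2)]
      G.l_inv[OF assms(2)] hbar_one[OF assms(1)] by metis
  then show ?thesis by simp
qed

lemma hbar_finprod:
  assumes "rank2_lattice L" "f \<in> A \<rightarrow> carrier (quot L)"
  shows "hbar (finprod (quot L) f A) = (\<Sum>x\<in>A. hbar (f x))"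
proof -
  interpret G: comm_group "quot L" by (rule comm_group_quot[OF assms(1)])
  show ?thesis
    by (rule G.finprod_to_sum[OF hbar_one[OF assms(1)] hbar_mult[OF assms(1)] assms(2)])
qed

section \<open>Scaling rows and columns\<close>

lemma pconst_mult: "pconst (a * b) = pconst a * pconst b"
  by (simp add: pconst_def mult_single)

lemma pconst_one: "pconst 1 = 1"
  by (simp add: pconst_def)

lemma pconst_prod: "pconst (\<Prod>x\<in>A. f x) = (\<Prod>x\<in>A. pconst (f x))"
  by (induction A rule: infinite_finite_induct) (simp_all add: pconst_mult pconst_one)

lemma diag_mat_mult_nth: "(diag_mat r ** M ** diag_mat c) $ i $ j = r i * M $ i $ j * c j"
  by (simp add: matrix_matrix_mult_def diag_mat_def if_distrib[of "\<lambda>x. x * _"]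
      if_distrib[of "\<lambda>x. _ * x"] cong: if_cong)

lemma det_diag_mat: "det (diag_mat d) = (\<Prod>i\<in>UNIV. d i)"
  by (subst det_diagonal) (simp_all add: diag_mat_def)

text \<open>A labelling turns the two rectangular-typed diagonal factors into square diagonal matrices on
  the label set, where multiplicativity of the determinant applies.\<close>

lemma labelled_det_diag_scale:
  fixes M :: "'a::comm_ring_1 ^ 'w::finite ^ 'b::finite"
    and p :: "'k::finite \<Rightarrow> 'b" and q :: "'k \<Rightarrow> 'w"
  assumes "bij p" "bij q"
  shows "labelled_det p q (diag_mat r ** M ** diag_mat c) =
    (\<Prod>b\<in>UNIV. r b) * (\<Prod>w\<in>UNIV. c w) * labelled_det p q M"
proof -
  let ?M = "(\<chi> i j. M $ p i $ q j) :: 'a ^ 'k ^ 'k"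
  have "(\<chi> i j. (diag_mat r ** M ** diag_mat c) $ p i $ q j) =
      diag_mat (\<lambda>k. r (p k)) ** ?M ** diag_mat (\<lambda>k. c (q k))"
    by (simp add: vec_eq_iff diag_mat_mult_nth)
  then have "labelled_det p q (diag_mat r ** M ** diag_mat c) =
      (\<Prod>k\<in>UNIV. r (p k)) * det ?M * (\<Prod>k\<in>UNIV. c (q k))"
    by (simp add: labelled_det_def det_mul det_diag_mat)
  also have "(\<Prod>k\<in>UNIV. r (p k)) = (\<Prod>b\<in>UNIV. r b)"
    by (rule prod.reindex_bij_betw[OF assms(1)])
  also have "(\<Prod>k\<in>UNIV. c (q k)) = (\<Prod>w\<in>UNIV. c w)"
    by (rule prod.reindex_bij_betw[OF assms(2)])
  finally show ?thesis by (simp add: labelled_det_def ac_simps)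
qed

text \<open>All arrows from row \<open>b\<close> to column \<open>w\<close> pick up the same scalar, although their end points
  differ: Condition 2 expresses it through the two cells alone.\<close>

lemma biadj_act_u:
  assumes L: "rank2_lattice L" and C2: "condition2 L a P eb ew" and \<xi>: "\<xi> \<in> char_group L"
  shows "biadj P zvar (act_u L \<xi>) =
    diag_mat (\<lambda>b. pconst (\<xi> (eb b))) ** biadj P zvar uvar
      ** diag_mat (\<lambda>w. pconst (\<xi> (inv\<^bsub>quot L\<^esub> ew w)))"
proof -
  interpret G: comm_group "quot L" by (rule comm_group_quot[OF L])
  have scalar: "\<xi> (avec L (src P e)) * \<xi> (avec L (tgt P e)) =
      \<xi> (eb (black P e)) * \<xi> (inv\<^bsub>quot L\<^esub> ew (white P e))" for e
  proof -
    have "\<xi> (avec L (src P e) \<otimes>\<^bsub>quot L\<^esub> avec L (tgt P e)) =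
        \<xi> (eb (black P e) \<otimes>\<^bsub>quot L\<^esub> inv\<^bsub>quot L\<^esub> ew (white P e))"
      using C2 by (simp only: condition2_def)
    moreover have "eb (black P e) \<in> carrier (quot L)"
      "inv\<^bsub>quot L\<^esub> ew (white P e) \<in> carrier (quot L)"
      using C2 by (simp_all add: condition2_def G.inv_closed del: mult_FactGroup)
    ultimately show ?thesis using char_mult[OF \<xi>] avec_closed by metis
  qed
  have summand: "zvar e * act_u L \<xi> (src P e) * act_u L \<xi> (tgt P e) =
      pconst (\<xi> (eb (black P e))) * (zvar e * uvar (src P e) * uvar (tgt P e))
        * pconst (\<xi> (inv\<^bsub>quot L\<^esub> ew (white P e)))" for e
  proof -
    have "zvar e * act_u L \<xi> (src P e) * act_u L \<xi> (tgt P e) =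
        pconst (\<xi> (avec L (src P e)) * \<xi> (avec L (tgt P e)))
          * (zvar e * uvar (src P e) * uvar (tgt P e))"
      by (simp add: act_u_def pconst_mult ac_simps)
    then show ?thesis unfolding scalar by (simp add: pconst_mult ac_simps)
  qed
  show ?thesis
    unfolding vec_eq_iff diag_mat_mult_nth
    by (auto simp: biadj_def summand sum_distrib_left sum_distrib_right intro!: sum.cong)
qed

text \<open>The second relation of Condition 2 identifies the scalar collected by the determinant from all
  rows and columns.\<close>

lemma prod_char_eps:
  assumes L: "rank2_lattice L" and C2: "condition2 L a P eb ew" and \<xi>: "\<xi> \<in> char_group L"
  shows "(\<Prod>b\<in>UNIV. \<xi> (eb b)) * (\<Prod>w\<in>UNIV. \<xi> (inv\<^bsub>quot L\<^esub> ew w)) = \<xi> a"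
proof -
  interpret G: comm_group "quot L" by (rule comm_group_quot[OF L])
  have eb: "eb \<in> UNIV \<rightarrow> carrier (quot L)" and ew: "ew \<in> UNIV \<rightarrow> carrier (quot L)"
    using C2 by (simp_all add: condition2_def)
  have a: "a = finprod (quot L) eb UNIV \<otimes>\<^bsub>quot L\<^esub> inv\<^bsub>quot L\<^esub> finprod (quot L) ew UNIV"
    using C2 by (simp only: condition2_def)
  have "\<xi> a = (\<Prod>b\<in>UNIV. \<xi> (eb b)) * inverse (\<Prod>w\<in>UNIV. \<xi> (ew w))"
    unfolding a char_mult[OF \<xi> G.finprod_closed[OF eb] G.inv_closed[OF G.finprod_closed[OF ew]]]
    by (simp add: char_inv[OF L \<xi> G.finprod_closed[OF ew]] char_finprod[OF L \<xi>] eb ew)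
  also have "inverse (\<Prod>w\<in>UNIV. \<xi> (ew w)) = (\<Prod>w\<in>UNIV. \<xi> (inv\<^bsub>quot L\<^esub> ew w))"
    using ew by (simp add: prod_inversef[symmetric] char_inv[OF L \<xi>] Pi_iff comp_def)
  finally show ?thesis by simp
qed

section \<open>Homogeneity\<close>

text \<open>The zero polynomial is homogeneous of every degree. Closure under sums therefore holds without
  excluding cancellation, which a statement about exact degrees would have to do.\<close>

definition homogeneous_in :: "'v set \<Rightarrow> nat \<Rightarrow> (('v::finite \<Rightarrow>\<^sub>0 nat) \<Rightarrow>\<^sub>0 'r::zero) \<Rightarrow> bool" where
  "homogeneous_in V d p \<longleftrightarrow>
     (\<forall>m\<in>Poly_Mapping.keys p. (\<Sum>v\<in>V. Poly_Mapping.lookup m v) = d)"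

lemma deg_in_homogeneous:
  assumes "homogeneous_in V d p" "p \<noteq> 0"
  shows "deg_in V p = d"
proof -
  have "(\<lambda>m. \<Sum>v\<in>V. Poly_Mapping.lookup m v) ` Poly_Mapping.keys p = {d}"
    using assms by (auto simp: homogeneous_in_def image_iff set_eq_iff) (metis keys_eq_empty ex_in_conv)
  then show ?thesis by (simp add: deg_in_def)
qed

lemma homogeneous_in_one: "homogeneous_in V 0 1"
  by (simp add: homogeneous_in_def)

lemma homogeneous_in_uminus:
  fixes p :: "('v::finite \<Rightarrow>\<^sub>0 nat) \<Rightarrow>\<^sub>0 'r::ab_group_add"
  shows "homogeneous_in V d p \<Longrightarrow> homogeneous_in V d (- p)"
  by (auto simp: homogeneous_in_def in_keys_iff)

lemma homogeneous_in_sum: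
  assumes "\<And>x. x \<in> A \<Longrightarrow> homogeneous_in V d (f x)"
  shows "homogeneous_in V d (\<Sum>x\<in>A. f x)"
  using assms
proof (induction A rule: infinite_finite_induct)
  case (insert a A)
  then show ?case
    using Poly_Mapping.keys_add[of "f a" "sum f A"] by (auto simp: homogeneous_in_def)
qed (simp_all add: homogeneous_in_def)

lemma homogeneous_in_mult:
  fixes p q :: "('v::finite \<Rightarrow>\<^sub>0 nat) \<Rightarrow>\<^sub>0 'r::comm_ring_1"
  assumes "homogeneous_in V c p" "homogeneous_in V d q"
  shows "homogeneous_in V (c + d) (p * q)"
  using Poly_Mapping.keys_mult[of p q] assms
  by (fastforce simp: homogeneous_in_def lookup_add sum.distrib)

lemma homogeneous_in_prod:
  fixes f :: "'i \<Rightarrow> ('v::finite \<Rightarrow>\<^sub>0 nat) \<Rightarrow>\<^sub>0 'r::comm_ring_1"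
  assumes "finite A" "\<And>x. x \<in> A \<Longrightarrow> homogeneous_in V d (f x)"
  shows "homogeneous_in V (card A * d) (\<Prod>x\<in>A. f x)"
  using assms
  by (induction A rule: finite_induct) (simp_all add: homogeneous_in_one homogeneous_in_mult)

lemma homogeneous_in_pvar: "homogeneous_in V (if v \<in> V then 1 else 0) (pvar v)"
  by (auto simp: homogeneous_in_def pvar_def lookup_single when_def)

lemma homogeneous_in_labelled_det:
  fixes M :: "((('v::finite \<Rightarrow>\<^sub>0 nat) \<Rightarrow>\<^sub>0 'r::comm_ring_1) ^ 'w ^ 'b)"
    and p :: "'k::finite \<Rightarrow> 'b" and q :: "'k \<Rightarrow> 'w"
  assumes "\<And>b w. homogeneous_in V d (M $ b $ w)"
  shows "homogeneous_in V (CARD('k) * d) (labelled_det p q M)"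
  unfolding labelled_det_def det_def
proof (rule homogeneous_in_sum)
  fix \<sigma> :: "'k \<Rightarrow> 'k"
  have "homogeneous_in V (CARD('k) * d) (\<Prod>i\<in>UNIV. M $ p i $ q (\<sigma> i))"
    by (rule homogeneous_in_prod) (simp_all add: assms)
  then show "homogeneous_in V (CARD('k) * d)
      (of_int (sign \<sigma>) * (\<Prod>i\<in>UNIV. (\<chi> i j. M $ p i $ q j) $ i $ \<sigma> i))"
    by (simp add: sign_def homogeneous_in_uminus)
qed

lemma homogeneous_in_biadj:
  "homogeneous_in (range Inl) 1
     (biadj P zvar uvar $ b $ w :: ('e::finite, 'n::finite, 'r::comm_ring_1) zupoly)"
  "homogeneous_in (range Inr) 2
     (biadj P zvar uvar $ b $ w :: ('e::finite, 'n::finite, 'r::comm_ring_1) zupoly)"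
proof -
  let ?m = "\<lambda>e. zvar e * uvar (src P e) * uvar (tgt P e) :: ('e, 'n, 'r) zupoly"
  have "homogeneous_in (range Inl) (1 + 0 + 0) (?m e)" for e
    unfolding zvar_def uvar_def
    by (intro homogeneous_in_mult) (use homogeneous_in_pvar[of "range Inl"] in \<open>force split: if_splits\<close>)+
  moreover have "homogeneous_in (range Inr) (0 + 1 + 1) (?m e)" for e
    unfolding zvar_def uvar_def
    by (intro homogeneous_in_mult) (use homogeneous_in_pvar[of "range Inr"] in \<open>force split: if_splits\<close>)+
  ultimately show
    "homogeneous_in (range Inl) 1 (biadj P zvar uvar $ b $ w :: ('e, 'n, 'r) zupoly)"
    "homogeneous_in (range Inr) 2 (biadj P zvar uvar $ b $ w :: ('e, 'n, 'r) zupoly)"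
    by (auto simp: biadj_def numeral_2_eq_2 intro!: homogeneous_in_sum)
qed

section \<open>Perfect matchings and the value of hbar\<close>

text \<open>An entry of the bi-adjacency matrix is a sum over the arrows joining the two cells, so it
  can be nonzero only if such an arrow exists; a nonzero Leibniz term provides one for each row.\<close>

lemma labelled_det_nonzero_matching:
  fixes p :: "'k::finite \<Rightarrow> 'b::finite" and q :: "'k \<Rightarrow> 'w::finite"
  assumes "labelled_det p q (biadj P z u) \<noteq> 0"
  obtains \<sigma> m where "bij \<sigma>" "\<And>k. black P (m k) = p k" "\<And>k. white P (m k) = q (\<sigma> k)"
proof -
  let ?M = "biadj P z u"
  have "\<exists>\<sigma>\<in>{\<sigma>. \<sigma> permutes (UNIV :: 'k set)}.
      of_int (sign \<sigma>) * (\<Prod>k\<in>UNIV. ?M $ p k $ q (\<sigma> k)) \<noteq> 0"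
  proof (rule ccontr)
    assume "\<not> ?thesis"
    then have "labelled_det p q ?M = 0"
      unfolding labelled_det_def det_def by (intro sum.neutral) simp
    with assms show False by contradiction
  qed
  then obtain \<sigma> where \<sigma>: "\<sigma> permutes (UNIV :: 'k set)"
    and nz: "of_int (sign \<sigma>) * (\<Prod>k\<in>UNIV. ?M $ p k $ q (\<sigma> k)) \<noteq> 0" by blast
  have "\<exists>e. black P e = p k \<and> white P e = q (\<sigma> k)" for k
  proof (rule ccontr)
    assume "\<not> ?thesis"
    then have "{e. black P e = p k \<and> white P e = q (\<sigma> k)} = {}" by blast
    then have "?M $ p k $ q (\<sigma> k) = 0" by (simp only: biadj_def vec_lambda_beta sum.empty)
    then have "(\<Prod>k\<in>UNIV. ?M $ p k $ q (\<sigma> k)) = 0" by (intro prod_zero) auto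
    with nz show False by simp
  qed
  then obtain m where "\<And>k. black P (m k) = p k \<and> white P (m k) = q (\<sigma> k)" by metis
  with permutes_bij[OF \<sigma>] that show thesis by blast
qed

text \<open>Each arrow of a perfect matching contributes 2, because \<open>h(a\<^sub>i) = 1\<close> for both of its ends,
  and the matching meets every \<open>\<epsilon>\<^sub>b\<close> and every \<open>\<epsilon>\<^sub>w\<close> exactly once.\<close>

lemma hbar_of_matching:
  fixes P :: "('n::finite, 'e::finite, 'b::finite, 'w::finite) quiver"
    and p :: "'k::finite \<Rightarrow> 'b" and q :: "'k \<Rightarrow> 'w"
  assumes L: "rank2_lattice L" and C2: "condition2 L a P eb ew"
    and "bij p" "bij q"
    and match: "\<And>k. black P (m k) = p k" "\<And>k. white P (m k) = q k"
  shows "hbar a = 2 * int CARD('k)"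
proof -
  interpret G: comm_group "quot L" by (rule comm_group_quot[OF L])
  have eb: "eb b \<in> carrier (quot L)" and ew: "ew w \<in> carrier (quot L)" for b w
    using C2 by (simp_all add: condition2_def)
  have a: "a = finprod (quot L) eb UNIV \<otimes>\<^bsub>quot L\<^esub> inv\<^bsub>quot L\<^esub> finprod (quot L) ew UNIV"
    using C2 by (simp only: condition2_def)
  have arrow: "hbar (eb (black P e)) - hbar (ew (white P e)) = 2" for e
  proof -
    have "hbar (avec L (src P e) \<otimes>\<^bsub>quot L\<^esub> avec L (tgt P e)) =
        hbar (eb (black P e) \<otimes>\<^bsub>quot L\<^esub> inv\<^bsub>quot L\<^esub> ew (white P e))"
      using C2 by (simp only: condition2_def)
    then show ?thesis
      using hbar_mult[OF L avec_closed avec_closed] hbar_avec[OF L]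
        hbar_mult[OF L eb G.inv_closed[OF ew]] hbar_inv[OF L ew] by simp
  qed
  have "hbar a = (\<Sum>b\<in>UNIV. hbar (eb b)) - (\<Sum>w\<in>UNIV. hbar (ew w))"
    unfolding a
    using hbar_mult[OF L G.finprod_closed G.inv_closed[OF G.finprod_closed], of eb UNIV ew UNIV]
      hbar_inv[OF L G.finprod_closed, of ew UNIV] hbar_finprod[OF L, of eb UNIV]
      hbar_finprod[OF L, of ew UNIV] eb ew by simp
  also have "(\<Sum>b\<in>UNIV. hbar (eb b)) = (\<Sum>k\<in>UNIV. hbar (eb (p k)))"
    by (rule sum.reindex_bij_betw[OF assms(3), symmetric])
  also have "(\<Sum>w\<in>UNIV. hbar (ew w)) = (\<Sum>k\<in>UNIV. hbar (ew (q k)))"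
    by (rule sum.reindex_bij_betw[OF assms(4), symmetric])
  also have "(\<Sum>k\<in>UNIV. hbar (eb (p k))) - (\<Sum>k\<in>UNIV. hbar (ew (q k))) = (\<Sum>k::'k\<in>UNIV. 2)"
    unfolding sum_subtractf[symmetric] using arrow match by (metis (no_types, lifting))
  finally show ?thesis by simp
qed

theorem theorem1:
  fixes L :: "('n::{finite,linorder} zvec) set"
    and B :: "'n zmat2"
    and c :: "real ^ 2"
    and P :: "('n, 'e::finite, 'b::finite, 'w::finite) quiver"
    and eb :: "'b \<Rightarrow> ('n zvec) set"
    and ew :: "'w \<Rightarrow> ('n zvec) set"
  assumes "rank2_lattice L"
    and "is_basis_matrix L B"
    and "generic_direction B c"
    and "condition1 P"
    and "condition2 L (a0 L B c) P eb ew"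
  shows
    "(\<forall>\<xi>\<in>char_group L.
        biadj P zvar (act_u L \<xi>) =
          diag_mat (\<lambda>b. pconst (\<xi> (eb b))) ** biadj P zvar uvar
            ** diag_mat (\<lambda>w. pconst (\<xi> (inv\<^bsub>quot L\<^esub> ew w))) \<and>
        (\<forall>p q. bij (p :: 'k::finite \<Rightarrow> 'b) \<and> bij (q :: 'k \<Rightarrow> 'w) \<longrightarrow>
          labelled_det p q (biadj P zvar (act_u L \<xi>)) =
            pconst (chi_char L B c \<xi>) * labelled_det p q (biadj P zvar uvar))) \<and>
     (\<forall>p q. bij (p :: 'k \<Rightarrow> 'b) \<and> bij (q :: 'k \<Rightarrow> 'w) \<longrightarrow>
        (let D = labelled_det p q (biadj P zvar uvar) :: ('e, 'n, int) zupoly in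
         D \<noteq> 0 \<longrightarrow>
           rat_of_nat (deg_z D) = 1/2 * rat_of_nat (deg_u D) \<and>
           1/2 * rat_of_nat (deg_u D) = rat_of_nat CARD('b) \<and>
           CARD('b) = CARD('w) \<and>
           rat_of_nat CARD('w) = 1/2 * rat_of_int (hbar (a0 L B c))))"
proof (intro conjI ballI allI impI)
  fix \<xi> assume \<xi>: "\<xi> \<in> char_group L"
  show scale: "biadj P zvar (act_u L \<xi>) =
      diag_mat (\<lambda>b. pconst (\<xi> (eb b))) ** biadj P zvar uvar
        ** diag_mat (\<lambda>w. pconst (\<xi> (inv\<^bsub>quot L\<^esub> ew w)))"
    by (rule biadj_act_u[OF assms(1,5) \<xi>])
  fix p :: "'k \<Rightarrow> 'b" and q :: "'k \<Rightarrow> 'w"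
  assume "bij p \<and> bij q"
  then show "labelled_det p q (biadj P zvar (act_u L \<xi>)) =
      pconst (chi_char L B c \<xi>) * labelled_det p q (biadj P zvar uvar)"
    by (simp only: scale labelled_det_diag_scale chi_char_def
        prod_char_eps[OF assms(1,5) \<xi>, symmetric] pconst_mult pconst_prod)
next
  fix p :: "'k \<Rightarrow> 'b" and q :: "'k \<Rightarrow> 'w"
  assume pq: "bij p \<and> bij q"
  define D :: "('e, 'n, int) zupoly" where "D = labelled_det p q (biadj P zvar uvar)"
  have card: "CARD('k) = CARD('b)" "CARD('b) = CARD('w)"
    using pq bij_betw_same_card assms(4) by (auto simp: condition1_def)
  {
    assume D: "D \<noteq> 0"
    have "homogeneous_in (range Inl) (CARD('k) * 1) D" "homogeneous_in (range Inr) (CARD('k) * 2) D"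
      unfolding D_def by (intro homogeneous_in_labelled_det homogeneous_in_biadj)+
    then have "deg_z D = CARD('k)" "deg_u D = 2 * CARD('k)"
      using deg_in_homogeneous D by (fastforce simp: deg_z_def deg_u_def)+
    moreover have "hbar (a0 L B c) = 2 * int CARD('k)"
    proof -
      obtain \<sigma> m where m: "bij \<sigma>" "\<And>k. black P (m k) = p k" "\<And>k. white P (m k) = q (\<sigma> k)"
        using labelled_det_nonzero_matching D unfolding D_def by blast
      have "bij (\<lambda>k. q (\<sigma> k))"
        using bij_comp[OF m(1), of q] pq by (simp add: comp_def)
      with pq m show ?thesis
        using hbar_of_matching[OF assms(1,5), of p "\<lambda>k. q (\<sigma> k)" m] by blast
    qed
    ultimately have "rat_of_nat (deg_z D) = 1/2 * rat_of_nat (deg_u D) \<and>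
        1/2 * rat_of_nat (deg_u D) = rat_of_nat CARD('b) \<and> CARD('b) = CARD('w) \<and>
        rat_of_nat CARD('w) = 1/2 * rat_of_int (hbar (a0 L B c))"
      using card by simp
  }
  then show "let D = labelled_det p q (biadj P zvar uvar) :: ('e, 'n, int) zupoly in
      D \<noteq> 0 \<longrightarrow>
        rat_of_nat (deg_z D) = 1/2 * rat_of_nat (deg_u D) \<and>
        1/2 * rat_of_nat (deg_u D) = rat_of_nat CARD('b) \<and>
        CARD('b) = CARD('w) \<and>
        rat_of_nat CARD('w) = 1/2 * rat_of_int (hbar (a0 L B c))"
    unfolding Let_def D_def by blast
qed

end
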